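(* Let $F$ be a field with $\operatorname{char}(F)\neq 2$, and let $s$ be the involution on the algebra $UT_2(F)$ of $2\times 2$ upper triangular matrices given by $$\begin{pmatrix} a&c\\0&b\end{pmatrix}^{s}=\begin{pmatrix} b&-c\\0&a\end{pmatrix}\qquad (a,b,c\in F).$$ The set of all $*$-central polynomials of $(UT_2(F),s)$ is $$C(UT_2(F),s)=Id(UT_2(F),s)+\langle y_1\rangle^{TS( * )} .$$
   Context: All algebras are unitary and associative over $F$. Let $X=\{x_1,x_2,\ldots\}$ and $X^*=\{x_1^*,x_2^*,\ldots\}$ be disjoint infinite sets, and let $F\langle X\cup X^*\rangle$ be the free unitary associative $F$-algebra freely generated by $X\cup X^*$, with the $F$-linear involution $*$ determined by $x_i\leftrightarrow x_i^*$. Put $y_i=x_i+x_i^*$, $z_i=x_i-x_i^*$, $Y=\{y_1,y_2,\ldots\}$, $Z=\{z_1,z_2,\ldots\}$. Then $F\langle X\cup X^*\rangle=F\langle Y\cup Z\rangle$ is free on $Y\cup Z$, with $y_i^*=y_i$ and $z_i^*=-z_i$. For an algebra $A$ with involution $\circledast$, put $A^+=\{a\in A: a^\circledast=a\}$, $A^-=\{a\in A:a^\circledast=-a\}$. A polynomial $f(y_1,\ldots,y_n,z_1,\ldots,z_m)$ belongs to $Id(A,\circledast)$ (is a $*$-polynomial identity) if $f(a_1,\ldots,a_n,b_1,\ldots,b_m)=0$ for all $a_i\in A^+$, $b_j\in A^-$; it belongs to $C(A,\circledast)$ (is a $*$-central polynomial) if $f(a_1,\ldots,a_n,b_1,\ldots,b_m)\in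 Z(A)$, the center of $A$, for all $a_i\in A^+$, $b_j\in A^-$. A $*$-endomorphism of $F\langle Y\cup Z\rangle$ is a (unital) algebra endomorphism commuting with $*$. A $T( * )$-space is a vector subspace of $F\langle Y\cup Z\rangle$ closed under all $*$-endomorphisms; $\langle W\rangle^{TS( * )}$ is the smallest $T( * )$-space containing $W$. Equivalently it is spanned by all $f(g_1,\ldots,g_n,h_1,\ldots,h_m)$ with $f(y_1,\ldots,y_n,z_1,\ldots,z_m)\in W$, $g_i\in F\langle Y\cup Z\rangle^+$, $h_j\in F\langle Y\cup Z\rangle^-$. The sign $+$ between subspaces denotes the sum of vector subspaces. *)

theory Defs
  imports
    "HOL-Analysis.Analysis"
    "HOL-Library.Poly_Mapping"
    "HOL-Library.Set_Algebras"
begin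

section \<open>Algebras with involution\<close>

text \<open>
  The ring structure comes from the type class, the \<open>F\<close>-action is the parameter \<open>smul\<close>.
\<close>

locale unital_algebra = vector_space smul
  for smul :: "'f::field \<Rightarrow> 'a::ring_1 \<Rightarrow> 'a" +
  assumes scale_mult_left: "smul c x * y = smul c (x * y)"
    and scale_mult_right: "x * smul c y = smul c (x * y)"

locale algebra_involution = unital_algebra smul + Vector_Spaces.linear smul smul invol
  for smul :: "'f::field \<Rightarrow> 'a::ring_1 \<Rightarrow> 'a" and invol :: "'a \<Rightarrow> 'a" +
  assumes inv_mult: "invol (x * y) = invol y * invol x"
    and inv_inv: "invol (invol x) = x"

definition symmetric_part :: "('a::ring_1 \<Rightarrow> 'a) \<Rightarrow> 'a set" where
  "symmetric_part invol = {a. invol a = a}"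

definition skew_part :: "('a::ring_1 \<Rightarrow> 'a) \<Rightarrow> 'a set" where
  "skew_part invol = {a. invol a = - a}"

definition center :: "'a::ring_1 set" where
  "center = {c. \<forall>a. c * a = a * c}"

definition unital_algebra_hom ::
    "('f::field \<Rightarrow> 'a::ring_1 \<Rightarrow> 'a) \<Rightarrow> ('f \<Rightarrow> 'b::ring_1 \<Rightarrow> 'b) \<Rightarrow> ('a \<Rightarrow> 'b) \<Rightarrow> bool" where
  "unital_algebra_hom scaleA scaleB \<phi> \<longleftrightarrow>
     Vector_Spaces.linear scaleA scaleB \<phi> \<and> \<phi> 1 = 1 \<and> (\<forall>f g. \<phi> (f * g) = \<phi> f * \<phi> g)"


section \<open>The free algebra on the letters \<open>x\<^sub>i\<close>, \<open>x\<^sub>i\<^sup>*\<close> and its involution\<close>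

datatype letter = X nat | Xstar nat

text \<open>
  The free monoid, written additively because \<^typ>\<open>'w \<Rightarrow>\<^sub>0 'f\<close> carries the
  monoid algebra structure for an additive (not necessarily commutative) monoid \<open>'w\<close>.
\<close>

datatype 'v free_monoid = Word (letters: "'v list")

instantiation free_monoid :: (type) monoid_add
begin

definition zero_free_monoid :: "'a free_monoid" where
  "0 = Word []"

definition plus_free_monoid :: "'a free_monoid \<Rightarrow> 'a free_monoid \<Rightarrow> 'a free_monoid" where
  "u + v = Word (letters u @ letters v)"

instance
  by standard (simp_all add: zero_free_monoid_def plus_free_monoid_def)

end

type_synonym 'f free_algebra = "letter free_monoid \<Rightarrow>\<^sub>0 'f"

definition fscale :: "'f::field \<Rightarrow> ('v free_monoid \<Rightarrow>\<^sub>0 'f) \<Rightarrow> ('v free_monoid \<Rightarrow>\<^sub>0 'f)" where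
  "fscale c f = Poly_Mapping.single 0 c * f"

definition gen :: "'v \<Rightarrow> ('v free_monoid \<Rightarrow>\<^sub>0 'f::field)" where
  "gen v = Poly_Mapping.single (Word [v]) 1"

fun letter_star :: "letter \<Rightarrow> letter" where
  "letter_star (X i) = Xstar i"
| "letter_star (Xstar i) = X i"

definition word_star :: "letter free_monoid \<Rightarrow> letter free_monoid" where
  "word_star w = Word (rev (map letter_star (letters w)))"

text \<open>
  \<^term>\<open>Poly_Mapping.map_key\<close> precomposes with \<^term>\<open>word_star\<close>; as this map is its own
  inverse, each word \<open>w\<close> is sent to \<open>w\<^sup>*\<close> with unchanged coefficient.
\<close>

definition star :: "'f::field free_algebra \<Rightarrow> 'f free_algebra" where
  "star f = Poly_Mapping.map_key word_star f"

definition yvar :: "nat \<Rightarrow> 'f::field free_algebra" where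
  "yvar i = gen (X i) + gen (Xstar i)"

definition zvar :: "nat \<Rightarrow> 'f::field free_algebra" where
  "zvar i = gen (X i) - gen (Xstar i)"

lemma letter_star_letter_star [simp]: "letter_star (letter_star v) = v"
  by (cases v) simp_all

lemma word_star_word_star [simp]: "word_star (word_star w) = w"
  by (cases w) (simp add: word_star_def rev_map o_def)

lemma inj_word_star: "inj word_star"
  by (metis injI word_star_word_star)

lemma word_star_add: "word_star (u + v) = word_star v + word_star u"
  by (simp add: word_star_def plus_free_monoid_def)

lemma lookup_star: "Poly_Mapping.lookup (star f) w = Poly_Mapping.lookup f (word_star w)"
  unfolding star_def by (simp add: map_key.rep_eq inj_word_star)

lemma poly_mapping_induct [case_names single sum]:
  fixes f :: "'w \<Rightarrow>\<^sub>0 'b::ab_group_add"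
  assumes single: "\<And>k v. P (Poly_Mapping.single k v)" and sum: "\<And>f g. P f \<Longrightarrow> P g \<Longrightarrow> P (f + g)"
  shows "P f"
proof (induction f rule: update_induct)
  case const
  show ?case using single[of undefined 0] by simp
next
  case (update f a b)
  have "Poly_Mapping.update a b f = f + Poly_Mapping.single a b"
    using update by (intro poly_mapping_eqI)
      (auto simp: lookup_update lookup_add lookup_single when_def in_keys_iff)
  then show ?case using update single sum by simp
qed

lemma fscale_eq_map: "fscale c f = Poly_Mapping.map ((*) c) f"
  by (simp add: fscale_def mult_map_scale_conv_mult)

lemma lookup_fscale: "Poly_Mapping.lookup (fscale c f) w = c * Poly_Mapping.lookup f w"
  by (simp add: fscale_eq_map map.rep_eq when_def)

lemma star_single: "star (Poly_Mapping.single w c) = Poly_Mapping.single (word_star w) c"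
  by (rule poly_mapping_eqI) (auto simp: lookup_star lookup_single when_def)

lemma star_add: "star (f + g) = star f + star g"
  by (rule poly_mapping_eqI) (simp add: lookup_star lookup_add)

lemma free_unital_algebra:
  "unital_algebra (fscale :: 'f::field \<Rightarrow> ('v free_monoid \<Rightarrow>\<^sub>0 'f) \<Rightarrow> _)"
proof
  fix c :: 'f and f g :: "'v free_monoid \<Rightarrow>\<^sub>0 'f"
  have comm: "f * Poly_Mapping.single 0 c = Poly_Mapping.single 0 c * f"
  proof (induction f rule: poly_mapping_induct)
    case (single k v)
    then show ?case by (simp add: mult_single mult.commute)
  next
    case (sum f g)
    then show ?case by (simp add: algebra_simps)
  qed
  show "f * fscale c g = fscale c (f * g)"
    by (metis comm fscale_def mult.assoc)
  show "fscale c f * g = fscale c (f * g)"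
    by (simp add: fscale_def mult.assoc)
  show "fscale c (fscale d f) = fscale (c * d) f" for d
    by (simp add: fscale_def mult_single flip: mult.assoc)
qed (simp_all add: fscale_def distrib_left distrib_right single_add)

interpretation free: unital_algebra "fscale :: 'f::field \<Rightarrow> ('v free_monoid \<Rightarrow>\<^sub>0 'f) \<Rightarrow> _"
  by (rule free_unital_algebra)

lemma star_algebra_involution:
  "algebra_involution fscale (star :: 'f::field free_algebra \<Rightarrow> _)"
proof
  fix f g :: "'f free_algebra" and c :: 'f
  show "star (f + g) = star f + star g"
    by (rule star_add)
  show "star (fscale c f) = fscale c (star f)"
    by (rule poly_mapping_eqI) (simp add: lookup_star lookup_fscale)
  show "star (star f) = f"
    by (rule poly_mapping_eqI) (simp add: lookup_star)
  show "star (f * g) = star g * star f"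
  proof (induction f rule: poly_mapping_induct)
    case (single k v)
    show ?case
    proof (induction g rule: poly_mapping_induct)
      case (single l w)
      then show ?case by (simp add: star_single mult_single word_star_add mult.commute)
    next
      case (sum g h)
      then show ?case by (simp add: star_add algebra_simps)
    qed
  next
    case (sum f h)
    then show ?case by (simp add: star_add algebra_simps)
  qed
qed

lemma star_y: "star (yvar i) = (yvar i :: 'f::field free_algebra)"
  and star_z: "star (zvar i) = (- zvar i :: 'f free_algebra)"
proof -
  interpret algebra_involution fscale "star :: 'f free_algebra \<Rightarrow> _"
    by (rule star_algebra_involution)
  have "star (gen (X i)) = (gen (Xstar i) :: 'f free_algebra)"
    and "star (gen (Xstar i)) = (gen (X i) :: 'f free_algebra)"
    by (simp_all add: gen_def star_single word_star_def)
  then show "star (yvar i) = (yvar i :: 'f free_algebra)" "star (zvar i) = (- zvar i :: 'f free_algebra)"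
    by (simp_all add: yvar_def zvar_def add diff)
qed


subsection \<open>Freeness on \<open>Y \<union> Z\<close>\<close>

lemma unital_algebra_homI:
  assumes "unital_algebra sA" "unital_algebra sB"
    and "\<And>f g. \<phi> (f + g) = \<phi> f + \<phi> g" "\<And>c f. \<phi> (sA c f) = sB c (\<phi> f)"
    and "\<phi> 1 = 1" "\<And>f g. \<phi> (f * g) = \<phi> f * \<phi> g"
  shows "unital_algebra_hom sA sB \<phi>"
proof -
  interpret A: unital_algebra sA by fact
  interpret B: unital_algebra sB by fact
  have "Vector_Spaces.linear sA sB \<phi>"
    by unfold_locales (use assms in auto)
  with assms show ?thesis by (simp add: unital_algebra_hom_def)
qed

definition eval_hom ::
    "('f::field \<Rightarrow> 'a::ring_1 \<Rightarrow> 'a) \<Rightarrow> ('v \<Rightarrow> 'a) \<Rightarrow> ('v free_monoid \<Rightarrow>\<^sub>0 'f) \<Rightarrow> 'a" where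
  "eval_hom smul u f =
     (\<Sum>w\<in>Poly_Mapping.keys f. smul (Poly_Mapping.lookup f w) (prod_list (map u (letters w))))"

context unital_algebra
begin

lemma eval_hom_superset:
  assumes "finite S" "Poly_Mapping.keys f \<subseteq> S"
  shows "eval_hom smul u f =
     (\<Sum>w\<in>S. smul (Poly_Mapping.lookup f w) (prod_list (map u (letters w))))"
  unfolding eval_hom_def using assms
  by (intro sum.mono_neutral_left) (auto simp: in_keys_iff)

lemma eval_hom_add: "eval_hom smul u (f + g) = eval_hom smul u f + eval_hom smul u g"
proof -
  let ?S = "Poly_Mapping.keys f \<union> Poly_Mapping.keys g"
  have "Poly_Mapping.keys (f + g) \<subseteq> ?S" by (rule Poly_Mapping.keys_add)
  then show ?thesis
    by (subst (1 2 3) eval_hom_superset[of ?S])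
      (auto simp: lookup_add scale_left_distrib sum.distrib)
qed

lemma eval_hom_single:
  "eval_hom smul u (Poly_Mapping.single w c) = smul c (prod_list (map u (letters w)))"
  by (subst eval_hom_superset[of "{w}"]) auto

lemma eval_hom_mult: "eval_hom smul u (f * g) = eval_hom smul u f * eval_hom smul u g"
proof (induction f rule: poly_mapping_induct)
  case (single k v)
  show ?case
  proof (induction g rule: poly_mapping_induct)
    case (single l w)
    then show ?case
      by (simp add: mult_single eval_hom_single plus_free_monoid_def
          scale_mult_left scale_mult_right)
  next
    case (sum g h)
    then show ?case by (simp add: eval_hom_add algebra_simps)
  qed
next
  case (sum f h)
  then show ?case by (simp add: eval_hom_add algebra_simps)
qed

lemma eval_hom_hom: "unital_algebra_hom fscale smul (eval_hom smul u)"
proof (rule unital_algebra_homI[OF free_unital_algebra unital_algebra_axioms])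
  have single0: "eval_hom smul u (Poly_Mapping.single 0 c) = smul c 1" for c
    by (simp add: eval_hom_single zero_free_monoid_def)
  show "eval_hom smul u (fscale c f) = smul c (eval_hom smul u f)" for c f
    by (simp add: fscale_def eval_hom_mult single0 scale_mult_left)
  show "eval_hom smul u 1 = 1"
    using single0[of 1] by simp
qed (simp_all add: eval_hom_add eval_hom_mult)

lemma eval_hom_gen [simp]: "eval_hom smul u (gen v) = u v"
  by (simp add: gen_def eval_hom_single)

lemma hom_eq_eval_hom:
  assumes "unital_algebra_hom fscale smul \<phi>"
  shows "\<phi> = eval_hom smul (\<lambda>v. \<phi> (gen v))"
proof
  interpret h: Vector_Spaces.linear fscale smul \<phi>
    using assms by (simp add: unital_algebra_hom_def)
  have mult: "\<phi> (f * g) = \<phi> f * \<phi> g" and one: "\<phi> 1 = 1" for f g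
    using assms by (auto simp: unital_algebra_hom_def)
  have word: "\<phi> (Poly_Mapping.single (Word vs) 1) = prod_list (map (\<lambda>v. \<phi> (gen v)) vs)" for vs
  proof (induction vs)
    case Nil
    then show ?case using one by (simp flip: zero_free_monoid_def)
  next
    case (Cons v vs)
    have "Poly_Mapping.single (Word (v # vs)) 1 = gen v * Poly_Mapping.single (Word vs) (1::'f)"
      by (simp add: gen_def mult_single plus_free_monoid_def)
    then show ?case using Cons mult by simp
  qed
  fix f
  show "\<phi> f = eval_hom smul (\<lambda>v. \<phi> (gen v)) f"
  proof (induction f rule: poly_mapping_induct)
    case (single k c)
    have "Poly_Mapping.single k c = fscale c (Poly_Mapping.single k 1)"
      by (simp add: fscale_def mult_single)
    then have "\<phi> (Poly_Mapping.single k c) = smul c (\<phi> (Poly_Mapping.single k 1))"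
      by (metis h.scale)
    also have "\<dots> = eval_hom smul (\<lambda>v. \<phi> (gen v)) (Poly_Mapping.single k c)"
      using word[of "letters k"] by (simp add: eval_hom_single)
    finally show ?case .
  next
    case (sum f g)
    then show ?case by (simp add: eval_hom_add h.add)
  qed
qed

theorem free_on_y_z:
  assumes "CHAR('f) \<noteq> 2"
  shows "\<exists>!\<phi>. unital_algebra_hom fscale smul \<phi> \<and> (\<forall>i. \<phi> (yvar i) = a i) \<and> (\<forall>i. \<phi> (zvar i) = b i)"
proof -
  have two: "(2::'f) \<noteq> 0"
  proof
    assume "(2::'f) = 0"
    then have "of_nat 2 = (0::'f)" by simp
    then have "CHAR('f) dvd 2" by (simp only: of_nat_eq_0_iff_char_dvd)
    then have "CHAR('f) = 1 \<or> CHAR('f) = 2"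
      using two_is_prime_nat prime_nat_iff by blast
    then show False using assms CHAR_not_1' by auto
  qed
  have "inverse 2 + inverse 2 = (1::'f)"
    using two by (simp flip: mult_2)
  then have half: "smul (inverse 2) v + smul (inverse 2) v = v" for v
    by (metis scale_left_distrib scale_one)
  let ?u = "case_letter (\<lambda>i. smul (inverse 2) (a i + b i)) (\<lambda>i. smul (inverse 2) (a i - b i))"
  let ?\<phi> = "eval_hom smul ?u"
  show ?thesis
  proof (rule ex1I[of _ ?\<phi>])
    interpret h: Vector_Spaces.linear fscale smul ?\<phi>
      using eval_hom_hom[of ?u] unfolding unital_algebra_hom_def by blast
    have "?\<phi> (yvar i) = ?\<phi> (gen (X i)) + ?\<phi> (gen (Xstar i))" for i
      unfolding yvar_def by (rule h.add)
    moreover have "?\<phi> (zvar i) = ?\<phi> (gen (X i)) - ?\<phi> (gen (Xstar i))" for i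
      unfolding zvar_def by (rule h.diff)
    ultimately have "?\<phi> (yvar i) = a i" "?\<phi> (zvar i) = b i" for i
      using half[of "a i"] half[of "b i"]
      by (simp_all add: scale_right_distrib scale_right_diff_distrib algebra_simps)
    then show "unital_algebra_hom fscale smul ?\<phi> \<and> (\<forall>i. ?\<phi> (yvar i) = a i) \<and> (\<forall>i. ?\<phi> (zvar i) = b i)"
      using eval_hom_hom by simp
  next
    fix \<psi> assume \<psi>: "unital_algebra_hom fscale smul \<psi> \<and> (\<forall>i. \<psi> (yvar i) = a i) \<and> (\<forall>i. \<psi> (zvar i) = b i)"
    interpret h: Vector_Spaces.linear fscale smul \<psi>
      using \<psi> by (simp add: unital_algebra_hom_def)
    have ab: "a i = \<psi> (gen (X i)) + \<psi> (gen (Xstar i))" "b i = \<psi> (gen (X i)) - \<psi> (gen (Xstar i))" for i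
      using \<psi> by (auto simp: yvar_def zvar_def h.add h.diff simp flip: all_simps)
    have "\<psi> (gen v) = ?u v" for v
      using half by (cases v) (simp_all add: ab flip: scale_right_distrib)
    then show "\<psi> = ?\<phi>"
      using hom_eq_eval_hom[of \<psi>] \<psi> by presburger
  qed
qed

end


section \<open>Identities, central polynomials and \<open>T(*)\<close>-spaces\<close>

text \<open>
  For a \<^const>\<open>unital_algebra_hom\<close> \<open>\<phi>\<close> with \<open>\<phi> (yvar i) = a i\<close> and \<open>\<phi> (zvar i) = b i\<close>, the value
  \<open>\<phi> f\<close> is \<open>f(a\<^sub>1,\<dots>,a\<^sub>n,b\<^sub>1,\<dots>,b\<^sub>m)\<close>; by \<open>free_on_y_z\<close> every choice of the \<open>a i\<close>, \<open>b i\<close>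
  comes from exactly one such \<open>\<phi>\<close> when the characteristic is not 2.
\<close>

definition admissible_substitution ::
    "('f::field \<Rightarrow> 'a::ring_1 \<Rightarrow> 'a) \<Rightarrow> ('a \<Rightarrow> 'a) \<Rightarrow> ('f free_algebra \<Rightarrow> 'a) \<Rightarrow> bool" where
  "admissible_substitution smul invol \<phi> \<longleftrightarrow>
     unital_algebra_hom fscale smul \<phi> \<and>
     (\<forall>i. \<phi> (yvar i) \<in> symmetric_part invol) \<and> (\<forall>i. \<phi> (zvar i) \<in> skew_part invol)"

definition star_identities ::
    "('f::field \<Rightarrow> 'a::ring_1 \<Rightarrow> 'a) \<Rightarrow> ('a \<Rightarrow> 'a) \<Rightarrow> 'f free_algebra set" where
  "star_identities smul invol = {f. \<forall>\<phi>. admissible_substitution smul invol \<phi> \<longrightarrow> \<phi> f = 0}"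

definition star_central_polynomials ::
    "('f::field \<Rightarrow> 'a::ring_1 \<Rightarrow> 'a) \<Rightarrow> ('a \<Rightarrow> 'a) \<Rightarrow> 'f free_algebra set" where
  "star_central_polynomials smul invol =
     {f. \<forall>\<phi>. admissible_substitution smul invol \<phi> \<longrightarrow> \<phi> f \<in> center}"

definition star_endomorphism :: "('f::field free_algebra \<Rightarrow> 'f free_algebra) \<Rightarrow> bool" where
  "star_endomorphism \<phi> \<longleftrightarrow>
     unital_algebra_hom fscale fscale \<phi> \<and> (\<forall>f. \<phi> (star f) = star (\<phi> f))"

definition T_star_space :: "'f::field free_algebra set \<Rightarrow> bool" where
  "T_star_space V \<longleftrightarrow> free.subspace V \<and> (\<forall>\<phi>. star_endomorphism \<phi> \<longrightarrow> \<phi> ` V \<subseteq> V)"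

definition T_star_span :: "'f::field free_algebra set \<Rightarrow> 'f free_algebra set" where
  "T_star_span W = T_star_space hull W"

lemma T_star_space_T_star_span: "T_star_space (T_star_span W)"
  unfolding T_star_span_def
  by (rule hull_in) (auto simp: T_star_space_def free.subspace_Inter, blast)


section \<open>The algebra \<open>UT\<^sub>2(F)\<close> with the involution \<open>s\<close>\<close>

typedef (overloaded) 'f ut2 = "{M :: 'f::field ^ 2 ^ 2. M $ 2 $ 1 = 0}"
  morphisms matrix_of_ut2 ut2_of_matrix
  by (rule exI[of _ 0]) simp

setup_lifting type_definition_ut2

text \<open>The product \<open>*\<close> of the type \<^typ>\<open>'f ^ 2 ^ 2\<close> is componentwise; the matrix product is \<open>**\<close>.\<close>

instantiation ut2 :: (field) ring_1
begin

lift_definition zero_ut2 :: "'a ut2" is 0 by simp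
lift_definition one_ut2 :: "'a ut2" is "mat 1" by (simp add: mat_def)
lift_definition plus_ut2 :: "'a ut2 \<Rightarrow> 'a ut2 \<Rightarrow> 'a ut2" is "(+)" by simp
lift_definition minus_ut2 :: "'a ut2 \<Rightarrow> 'a ut2 \<Rightarrow> 'a ut2" is "(-)" by simp
lift_definition uminus_ut2 :: "'a ut2 \<Rightarrow> 'a ut2" is uminus by simp
lift_definition times_ut2 :: "'a ut2 \<Rightarrow> 'a ut2 \<Rightarrow> 'a ut2" is "(**)"
  by (simp add: matrix_matrix_mult_def sum_2)

instance
proof
  show "(0::'a ut2) \<noteq> 1"
    by transfer (auto simp: mat_def vec_eq_iff)
  fix a b c :: "'a ut2"
  show "a * b * c = a * (b * c)"
    by transfer (simp add: matrix_mul_assoc)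
  show "(a + b) * c = a * c + b * c"
    by transfer (simp add: vec_eq_iff matrix_matrix_mult_def sum_2 distrib_right)
  show "a * (b + c) = a * b + a * c"
    by transfer (simp add: matrix_add_ldistrib)
qed (transfer; simp)+

end

lift_definition ut2_scale :: "'f::field \<Rightarrow> 'f ut2 \<Rightarrow> 'f ut2" is "\<lambda>c M. \<chi> i j. c * M $ i $ j" by simp

lift_definition ut2_s :: "'f::field ut2 \<Rightarrow> 'f ut2" is
  "\<lambda>M. vector [vector [M $ 2 $ 2, - M $ 1 $ 2], vector [0, M $ 1 $ 1]]"
  by simp

lemma ut2_s_algebra_involution:
  "algebra_involution ut2_scale (ut2_s :: 'f::field ut2 \<Rightarrow> _)"
  by standard
    (transfer; simp add: vec_eq_iff forall_2 matrix_matrix_mult_def sum_2 algebra_simps)+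

end

theory Submission
  imports Defs
begin

text \<open>
  The symmetric elements of \<open>(UT\<^sub>2(F), s)\<close> are exactly the scalar matrices, that is, the centre,
  so the only central skew element is \<open>0\<close>. The \<open>T(*)\<close>-space generated by \<open>y\<^sub>1\<close> consists of all
  symmetric polynomials. Splitting a central polynomial \<open>f\<close> as \<open>(f + f\<^sup>*)/2 + (f - f\<^sup>*)/2\<close>, the
  first summand is symmetric, and the values of the second are skew and central, hence \<open>0\<close>.
\<close>

lemma two_neq_zero:
  assumes "CHAR('f::field) \<noteq> 2"
  shows "(2::'f) \<noteq> 0"
proof
  assume "(2::'f) = 0"
  then have "of_nat 2 = (0::'f)" by simp
  then have "CHAR('f) dvd 2" by (simp only: of_nat_eq_0_iff_char_dvd)
  then have "CHAR('f) = 1 \<or> CHAR('f) = 2"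
    using two_is_prime_nat prime_nat_iff by blast
  then show False using assms CHAR_not_1' by auto
qed

lemma (in unital_algebra) scale_half_double:
  assumes "CHAR('f) \<noteq> 2"
  shows "smul (inverse 2) (x + x) = x"
proof -
  have "smul (inverse 2) (x + x) = smul (inverse 2 + inverse 2) x"
    by (simp only: scale_right_distrib scale_left_distrib)
  also have "inverse 2 + inverse 2 = (1::'f)"
    using two_neq_zero[OF assms] by (simp flip: mult_2)
  finally show ?thesis by simp
qed

text \<open>Unitality is not an axiom of \<open>algebra_involution\<close>. It follows by applying
  \<open>invol\<close> to the product \<open>invol 1 * 1\<close> and reversing the factors.\<close>

lemma (in algebra_involution) invol_one: "invol 1 = 1"
  by (metis inv_inv inv_mult mult_1_left mult_1_right)

context algebra_involution
begin

text \<open>Both \<open>star\<close> and \<open>invol\<close> reverse products, so the two reversals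
  cancel. Being a homomorphism, the conjugate can be compared with \<open>\<phi>\<close> on
  generators alone.\<close>

lemma hom_conjugate:
  fixes \<phi> :: "'f free_algebra \<Rightarrow> 'a"
  assumes "unital_algebra_hom fscale smul \<phi>"
  shows "unital_algebra_hom fscale smul (\<lambda>f. invol (\<phi> (star f)))"
proof (rule unital_algebra_homI[OF free_unital_algebra unital_algebra_axioms])
  interpret st: algebra_involution fscale "star :: 'f free_algebra \<Rightarrow> _"
    by (rule star_algebra_involution)
  interpret h: Vector_Spaces.linear fscale smul \<phi>
    using assms by (simp add: unital_algebra_hom_def)
  have m: "\<phi> (f * g) = \<phi> f * \<phi> g" and o: "\<phi> 1 = 1" for f g
    using assms by (auto simp: unital_algebra_hom_def)
  show "invol (\<phi> (star 1)) = 1"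
    by (simp add: st.invol_one o invol_one)
  show "invol (\<phi> (star (f + g))) = invol (\<phi> (star f)) + invol (\<phi> (star g))" for f g
    by (simp add: st.add h.add add)
  show "invol (\<phi> (star (fscale c f))) = smul c (invol (\<phi> (star f)))" for c f
    by (simp add: st.scale h.scale scale)
  show "invol (\<phi> (star (f * g))) = invol (\<phi> (star f)) * invol (\<phi> (star g))" for f g
    by (simp add: st.inv_mult m inv_mult)
qed

text \<open>Admissibility only constrains the values at the \<open>yvar i\<close> and
  \<open>zvar i\<close>. The conjugate of \<open>\<phi>\<close> has the same values there, the two
  signs at \<open>zvar i\<close> cancelling, so uniqueness in \<open>free_on_y_z\<close> identifies
  it with \<open>\<phi>\<close>.\<close>

lemma admissible_substitution_star:
  fixes \<phi> :: "'f free_algebra \<Rightarrow> 'a"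
  assumes "CHAR('f) \<noteq> 2" and "admissible_substitution smul invol \<phi>"
  shows "\<phi> (star f) = invol (\<phi> f)"
proof -
  let ?\<psi> = "\<lambda>f. invol (\<phi> (star f))"
  have \<phi>: "unital_algebra_hom fscale smul \<phi>"
    and y: "invol (\<phi> (yvar i)) = \<phi> (yvar i)" and z: "invol (\<phi> (zvar i)) = - \<phi> (zvar i)" for i
    using assms(2) by (auto simp: admissible_substitution_def symmetric_part_def skew_part_def)
  interpret h: Vector_Spaces.linear fscale smul \<phi>
    using \<phi> by (simp add: unital_algebra_hom_def)
  have "?\<psi> (yvar i) = \<phi> (yvar i)" "?\<psi> (zvar i) = \<phi> (zvar i)" for i
    by (simp_all add: star_y star_z y z h.neg neg)
  with \<phi> hom_conjugate[OF \<phi>]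
    free_on_y_z[OF assms(1), of "\<lambda>i. \<phi> (yvar i)" "\<lambda>i. \<phi> (zvar i)"]
  have "?\<psi> = \<phi>" by auto
  then show ?thesis by (metis inv_inv)
qed

end

lemma star_endomorphism_eval_hom:
  fixes g :: "'f::field free_algebra"
  defines "u \<equiv> case_letter (\<lambda>_. g) (\<lambda>_. star g)"
  shows "star_endomorphism (eval_hom fscale u)"
proof -
  interpret st: algebra_involution fscale "star :: 'f free_algebra \<Rightarrow> _"
    by (rule star_algebra_involution)
  let ?\<phi> = "eval_hom fscale u :: 'f free_algebra \<Rightarrow> 'f free_algebra"
  have \<phi>: "unital_algebra_hom fscale fscale ?\<phi>" by (rule free.eval_hom_hom)
  have gen_star: "star (gen v) = (gen (letter_star v) :: 'f free_algebra)" for v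
    by (simp add: gen_def star_single word_star_def)
  \<comment> \<open>Agreement on the letters \<open>gen v\<close> suffices, since a homomorphism is
    determined by its values there.\<close>
  have "star (?\<phi> (star (gen v))) = u v" for v
    by (cases v) (simp_all add: gen_star u_def st.inv_inv)
  then have "(\<lambda>f. star (?\<phi> (star f))) = ?\<phi>"
    using free.hom_eq_eval_hom[OF st.hom_conjugate[OF \<phi>]] by simp
  then have "?\<phi> (star f) = star (?\<phi> f)" for f
    by (metis st.inv_inv)
  with \<phi> show ?thesis by (simp add: star_endomorphism_def)
qed

text \<open>Endomorphisms commuting with \<open>star\<close> preserve symmetry, which bounds the
  span from above. Conversely, a symmetric \<open>f\<close> is half the image of
  \<open>yvar i\<close> under the endomorphism sending each \<open>X j\<close> to
  \<open>f\<close>.\<close>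

lemma T_star_span_yvar:
  assumes "CHAR('f::field) \<noteq> 2"
  shows "T_star_span {yvar i} = (symmetric_part star :: 'f free_algebra set)"
proof
  interpret st: algebra_involution fscale "star :: 'f free_algebra \<Rightarrow> _"
    by (rule star_algebra_involution)
  have "T_star_space (symmetric_part star :: 'f free_algebra set)"
    unfolding T_star_space_def free.subspace_def symmetric_part_def star_endomorphism_def
    by (auto simp: st.add st.scale st.zero) metis
  then show "T_star_span {yvar i} \<subseteq> (symmetric_part star :: 'f free_algebra set)"
    unfolding T_star_span_def by (intro hull_minimal) (auto simp: symmetric_part_def star_y)
  show "(symmetric_part star :: 'f free_algebra set) \<subseteq> T_star_span {yvar i}"
  proof
    fix f :: "'f free_algebra" assume f: "f \<in> symmetric_part star"
    let ?u = "case_letter (\<lambda>_. f) (\<lambda>_. star f)"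
    have "yvar i \<in> T_star_span {yvar i :: 'f free_algebra}"
      unfolding T_star_span_def by (simp add: hull_inc)
    then have "eval_hom fscale ?u (yvar i) \<in> T_star_span {yvar i :: 'f free_algebra}"
      using star_endomorphism_eval_hom[of f] T_star_space_T_star_span
      unfolding T_star_space_def by blast
    moreover have "eval_hom fscale ?u (yvar i) = f + f"
      using f by (simp add: yvar_def free.eval_hom_add symmetric_part_def)
    ultimately show "f \<in> T_star_span {yvar i}"
      using T_star_space_T_star_span[of "{yvar i :: 'f free_algebra}"]
        free.scale_half_double[OF assms, of f]
      unfolding T_star_space_def by (metis free.subspace_scale)
  qed
qed

text \<open>Comparing entries in \<open>ut2_s a = a\<close> gives equal diagonal entries and an
  off-diagonal entry equal to its own negative, hence 0. So \<open>a\<close> is a scalar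
  matrix.\<close>

lemma symmetric_part_ut2_s_subset_center:
  assumes "CHAR('f::field) \<noteq> 2"
  shows "symmetric_part ut2_s \<subseteq> (center :: 'f ut2 set)"
  unfolding symmetric_part_def center_def
proof clarify
  have two: "(2::'f) \<noteq> 0" by (rule two_neq_zero[OF assms])
  have eq0: "- c = c \<Longrightarrow> c = 0" for c :: 'f
    using two by (metis add.right_inverse mult_2 mult_eq_0_iff)
  fix a b :: "'f ut2" assume a: "ut2_s a = a"
  have "matrix_of_ut2 a $ 1 $ 1 = matrix_of_ut2 a $ 2 $ 2" "matrix_of_ut2 a $ 1 $ 2 = 0"
    using arg_cong[OF a, of "\<lambda>m. matrix_of_ut2 m $ 1 $ 1"]
      arg_cong[OF a, of "\<lambda>m. matrix_of_ut2 m $ 1 $ 2"]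
    by (simp_all add: ut2_s.rep_eq eq0)
  moreover have "matrix_of_ut2 a $ 2 $ 1 = 0" "matrix_of_ut2 b $ 2 $ 1 = 0"
    using matrix_of_ut2[of a] matrix_of_ut2[of b] by simp_all
  ultimately have "matrix_of_ut2 (a * b) = matrix_of_ut2 (b * a)"
    by (simp add: times_ut2.rep_eq vec_eq_iff forall_2 matrix_matrix_mult_def sum_2 mult.commute)
  then show "a * b = b * a" by (simp add: matrix_of_ut2_inject)
qed

text \<open>Skewness makes the diagonal entries opposite but leaves the corner entry free.
  Centrality must therefore both kill the corner and equate the diagonal entries.\<close>

lemma skew_part_ut2_s_Int_center:
  assumes "CHAR('f::field) \<noteq> 2"
    and "a \<in> skew_part ut2_s" "a \<in> (center :: 'f ut2 set)"
  shows "a = 0"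
proof -
  have two: "(2::'f) \<noteq> 0" by (rule two_neq_zero[OF assms(1)])
  have eq0: "c = - c \<Longrightarrow> c = 0" for c :: 'f
    using two by (metis add.right_inverse mult_2 mult_eq_0_iff)
  \<comment> \<open>Commuting with \<open>e\<close>, the sum of the matrix units E11 and E12, forces
    equal diagonal entries once the corner entry is 0; commuting with \<open>e'\<close>, which is
    E11, makes the corner entry 0.\<close>
  define e where "e = ut2_of_matrix (vector [vector [1, 1], vector [0, 0]] :: 'f ^ 2 ^ 2)"
  have e: "matrix_of_ut2 e = vector [vector [1, 1], vector [0, 0]]"
    unfolding e_def by (simp add: ut2_of_matrix_inverse)
  define e' where "e' = ut2_of_matrix (vector [vector [1, 0], vector [0, 0]] :: 'f ^ 2 ^ 2)"
  have e': "matrix_of_ut2 e' = vector [vector [1, 0], vector [0, 0]]"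
    unfolding e'_def by (simp add: ut2_of_matrix_inverse)
  let ?A = "matrix_of_ut2 a"
  have A21: "?A $ 2 $ 1 = 0" using matrix_of_ut2[of a] by simp
  have skew: "ut2_s a = - a" and comm: "a * e = e * a" "a * e' = e' * a"
    using assms by (auto simp: skew_part_def center_def)
  have "?A $ 2 $ 2 = - ?A $ 1 $ 1"
    using arg_cong[OF skew, of "\<lambda>m. matrix_of_ut2 m $ 1 $ 1"]
    by (simp add: ut2_s.rep_eq uminus_ut2.rep_eq)
  moreover have "?A $ 1 $ 2 = 0"
    using arg_cong[OF comm(2), of "\<lambda>m. matrix_of_ut2 m $ 1 $ 2"]
    by (simp add: times_ut2.rep_eq e' matrix_matrix_mult_def sum_2)
  moreover have "?A $ 1 $ 1 = ?A $ 1 $ 2 + ?A $ 2 $ 2"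
    using arg_cong[OF comm(1), of "\<lambda>m. matrix_of_ut2 m $ 1 $ 2"]
    by (simp add: times_ut2.rep_eq e matrix_matrix_mult_def sum_2)
  ultimately have "?A = 0"
    using A21 eq0[of "?A $ 1 $ 1"] by (simp add: vec_eq_iff forall_2)
  then show ?thesis
    by (metis matrix_of_ut2_inject zero_ut2.rep_eq)
qed

theorem theorem5p3:
  assumes "CHAR('f::field) \<noteq> 2"
  shows "star_central_polynomials (ut2_scale :: 'f \<Rightarrow> 'f ut2 \<Rightarrow> 'f ut2) ut2_s =
         star_identities (ut2_scale :: 'f \<Rightarrow> 'f ut2 \<Rightarrow> 'f ut2) ut2_s + T_star_span {yvar 1}"
    (is "?C = ?I + _")
proof -
  interpret st: algebra_involution fscale "star :: 'f free_algebra \<Rightarrow> _"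
    by (rule star_algebra_involution)
  interpret s: algebra_involution ut2_scale "ut2_s :: 'f ut2 \<Rightarrow> _"
    by (rule ut2_s_algebra_involution)
  note star = s.admissible_substitution_star[OF assms]
  have lin: "Vector_Spaces.linear fscale ut2_scale \<phi>"
    if "admissible_substitution (ut2_scale :: 'f \<Rightarrow> _) ut2_s \<phi>" for \<phi>
    using that by (simp add: admissible_substitution_def unital_algebra_hom_def)
  \<comment> \<open>\<open>\<phi>\<close> intertwines \<open>star\<close> and \<open>ut2_s\<close>,
    so it sends symmetric polynomials to symmetric matrices, which are central.\<close>
  have sym: "\<phi> g \<in> center"
    if "admissible_substitution (ut2_scale :: 'f \<Rightarrow> _) ut2_s \<phi>" "g \<in> symmetric_part star" for \<phi> g
    using star[OF that(1), of g] that(2) symmetric_part_ut2_s_subset_center[OF assms]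
    by (auto simp: symmetric_part_def)
  have "?C = ?I + symmetric_part star"
  proof (intro equalityI subsetI)
    fix f assume f: "f \<in> ?C"
    define g where "g = fscale (inverse 2) (f + star f)"
    have g: "g \<in> symmetric_part star"
      by (simp add: symmetric_part_def g_def st.scale st.add st.inv_inv add.commute)
    \<comment> \<open>In this form, free of fractions, skewness of \<open>f - g\<close> is
      immediate: \<open>star f - g = g - f\<close>.\<close>
    have "g + g = f + star f"
      using free.scale_half_double[OF assms, of "f + star f"]
      by (simp only: g_def free.scale_right_distrib)
    then have skew: "star (f - g) = - (f - g)"
      using g by (simp add: symmetric_part_def st.diff algebra_simps)
    have "\<phi> (f - g) = 0"
      if \<phi>: "admissible_substitution (ut2_scale :: 'f \<Rightarrow> _) ut2_s \<phi>" for \<phi>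
    proof (rule skew_part_ut2_s_Int_center[OF assms])
      interpret h: Vector_Spaces.linear fscale ut2_scale \<phi> by (rule lin[OF \<phi>])
      show "\<phi> (f - g) \<in> skew_part ut2_s"
        using star[OF \<phi>, of "f - g"] by (simp only: skew_part_def skew h.neg mem_Collect_eq)
      have "\<phi> f \<in> center" "\<phi> g \<in> center"
        using f \<phi> sym[OF \<phi> g] by (auto simp: star_central_polynomials_def)
      then show "\<phi> (f - g) \<in> center"
        by (simp add: center_def h.diff algebra_simps)
    qed
    then have "f - g \<in> ?I" by (simp add: star_identities_def)
    then show "f \<in> ?I + symmetric_part star"
      using g by (metis diff_add_cancel set_plus_intro)
  next
    fix f assume "f \<in> ?I + symmetric_part star"
    then obtain p g where f: "f = p + g" and p: "p \<in> ?I" and g: "g \<in> symmetric_part star"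
      by (rule set_plus_elim)
    have "\<phi> f \<in> center"
      if \<phi>: "admissible_substitution (ut2_scale :: 'f \<Rightarrow> _) ut2_s \<phi>" for \<phi>
    proof -
      interpret h: Vector_Spaces.linear fscale ut2_scale \<phi> by (rule lin[OF \<phi>])
      have "\<phi> p = 0" using p \<phi> by (simp add: star_identities_def)
      then show ?thesis using sym[OF \<phi> g] by (simp add: f h.add)
    qed
    then show "f \<in> ?C" by (simp add: star_central_polynomials_def)
  qed
  then show ?thesis by (simp add: T_star_span_yvar[OF assms])
qed

end
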